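(* Let $(X,\mu)$ be a generalized topological space. (a) $(X,\mu)$ is $T_{3.5}$ if and only if it is homeomorphic to a subspace $Y$ of a power $([0,1],\gamma_0)^J$ of the GTS $([0,1],\gamma_0)$, for some set $J$. If $|X|\ge 2$ and $(X,\mu)$ is $T_{3.5}$, we may even suppose that $Y$ is dense in the power. (b) $(X,\mu)$ is completely regular if and only if, for some set $J$, there is a function $\varphi:X\to[0,1]^J$ such that $\mu$ is the weak structure on $X$ with respect to the source consisting of the single map $\varphi$ into the underlying set of $([0,1],\gamma_0)^J$. If $\mu\not\subset\{\emptyset,X\}$ and $(X,\mu)$ is completely regular, we may even suppose that $\varphi$ is dense.
   Context: A generalized topology (GT) on a set $X$ (possibly empty) is a family $\mu\subset P(X)$ with $\emptyset\in\mu$ closed under arbitrary unions; $(X,\mu)$ is a GTS; members of $\mu$ are open, their complements closed. A map $f:(X,\mu)\to(Y,\nu)$ is continuous if $f^{-1}(N)\in\mu$ for all $N\in\nu$; a homeomorphism is a continuous bijection with continuous inverse. The closure of $A$ is the intersection of all closed sets containing $A$; $A\subset Y$ is dense in $(Y,\nu)$ if its closure is $Y$, and a map into $(Y,\nu)$ is dense if its image is dense. A base of $\mu$ is a subfamily $\beta\subset\mu$ such that each member of $\mu$ is a union of a (possibly empty) subfamily of $\beta$. The subspace on $X_0\subset X$ has GT $\{M\cap X_0\mid M\in\mu\}$. Products are categorical: $\prod_{\alpha\in J}(Y_\alpha,\nu_\alpha)$ is the set $\prod_\alpha Y_\alpha$ with the GT $\{\bigcup_{\alpha\in J}\pi_\alpha^{-1}(M_\alpha)\mid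 M_\alpha\in\nu_\alpha\}$, where the $\pi_\alpha$ are the projections; the empty product (0'th power) is a one-point set with GT $\{\emptyset\}$. For a function $\varphi:X\to Y$ into a GTS $(Y,\nu)$, the weak structure on $X$ with respect to $\varphi$ is $\{\varphi^{-1}(N)\mid N\in\nu\}$. $\gamma$ is the GT on $\mathbb{R}$ with base $\{(-\infty,s)\mid s\in\mathbb{R}\}\cup\{(t,\infty)\mid t\in\mathbb{R}\}$, and $\gamma_0$ is its subspace GT on $[0,1]$. A GTS $(X,\mu)$ is completely regular if for each $x\in X$ and each closed $F\subset X$ with $x\notin F$ there is a continuous $f:(X,\mu)\to([0,1],\gamma_0)$ with $f(x)=0$ and $f(F)\subset\{1\}$. It is $T_1$ if for any distinct $x,y\in X$ there is an open set containing $x$ but not $y$. It is $T_{3.5}$ if it is completely regular and $T_1$. *)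

theory Defs
  imports Complex_Main "HOL-Library.FuncSet"
begin

text \<open>A generalized topological space is given by a carrier \<open>X\<close> together with a family \<open>\<mu>\<close>.
  The carrier cannot be recovered from \<open>\<mu>\<close>, since \<open>X\<close> itself need not be open.\<close>

definition gen_topology :: "'a set \<Rightarrow> 'a set set \<Rightarrow> bool" where
  "gen_topology X \<mu> \<longleftrightarrow> \<mu> \<subseteq> Pow X \<and> {} \<in> \<mu> \<and> (\<forall>\<S>. \<S> \<subseteq> \<mu> \<longrightarrow> \<Union>\<S> \<in> \<mu>)"

definition gt_closed :: "'a set \<Rightarrow> 'a set set \<Rightarrow> 'a set \<Rightarrow> bool" where
  "gt_closed X \<mu> F \<longleftrightarrow> F \<subseteq> X \<and> X - F \<in> \<mu>"

definition gt_closure :: "'a set \<Rightarrow> 'a set set \<Rightarrow> 'a set \<Rightarrow> 'a set" where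
  "gt_closure X \<mu> A = \<Inter>{F. gt_closed X \<mu> F \<and> A \<subseteq> F}"

definition gt_dense :: "'a set \<Rightarrow> 'a set set \<Rightarrow> 'a set \<Rightarrow> bool" where
  "gt_dense X \<mu> A \<longleftrightarrow> A \<subseteq> X \<and> gt_closure X \<mu> A = X"

definition gt_continuous ::
    "'a set \<Rightarrow> 'a set set \<Rightarrow> 'b set \<Rightarrow> 'b set set \<Rightarrow> ('a \<Rightarrow> 'b) \<Rightarrow> bool" where
  "gt_continuous X \<mu> Y \<nu> f \<longleftrightarrow> f \<in> X \<rightarrow> Y \<and> (\<forall>N\<in>\<nu>. f -` N \<inter> X \<in> \<mu>)"

definition gt_homeomorphism ::
    "'a set \<Rightarrow> 'a set set \<Rightarrow> 'b set \<Rightarrow> 'b set set \<Rightarrow> ('a \<Rightarrow> 'b) \<Rightarrow> bool" where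
  "gt_homeomorphism X \<mu> Y \<nu> f \<longleftrightarrow>
     bij_betw f X Y \<and> gt_continuous X \<mu> Y \<nu> f \<and> gt_continuous Y \<nu> X \<mu> (inv_into X f)"

definition gt_homeomorphic ::
    "'a set \<Rightarrow> 'a set set \<Rightarrow> 'b set \<Rightarrow> 'b set set \<Rightarrow> bool" where
  "gt_homeomorphic X \<mu> Y \<nu> \<longleftrightarrow> (\<exists>f. gt_homeomorphism X \<mu> Y \<nu> f)"

definition gt_subspace :: "'a set set \<Rightarrow> 'a set \<Rightarrow> 'a set set" where
  "gt_subspace \<mu> X\<^sub>0 = {M \<inter> X\<^sub>0 | M. M \<in> \<mu>}"

text \<open>The generalized topology having \<open>\<beta>\<close> as a base.  Every family of subsets is a base of one,
  as no intersection condition is involved.\<close>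

definition gt_of_base :: "'a set set \<Rightarrow> 'a set set" where
  "gt_of_base \<beta> = {\<Union>\<S> | \<S>. \<S> \<subseteq> \<beta>}"

text \<open>The categorical product of the spaces \<open>(Y \<alpha>, \<nu> \<alpha>)\<close> has carrier \<open>Pi\<^sub>E J Y\<close>.  For empty \<open>J\<close>
  that carrier is the singleton \<open>{\<lambda>_. undefined}\<close>, with the empty set as its only open set.\<close>

definition gt_product ::
    "'j set \<Rightarrow> ('j \<Rightarrow> 'b set) \<Rightarrow> ('j \<Rightarrow> 'b set set) \<Rightarrow> ('j \<Rightarrow> 'b) set set" where
  "gt_product J Y \<nu> =
     {\<Union>\<alpha>\<in>J. (\<lambda>y. y \<alpha>) -` M \<alpha> \<inter> Pi\<^sub>E J Y | M. \<forall>\<alpha>\<in>J. M \<alpha> \<in> \<nu> \<alpha>}"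

definition weak_structure :: "'a set \<Rightarrow> 'b set set \<Rightarrow> ('a \<Rightarrow> 'b) \<Rightarrow> 'a set set" where
  "weak_structure X \<nu> \<phi> = {\<phi> -` N \<inter> X | N. N \<in> \<nu>}"

definition gamma :: "real set set" where
  "gamma = gt_of_base ({{..<s} | s. True} \<union> {{t<..} | t. True})"

definition gamma0 :: "real set set" where
  "gamma0 = gt_subspace gamma {0..1}"

definition cube :: "'j set \<Rightarrow> ('j \<Rightarrow> real) set" where
  "cube J = (\<Pi>\<^sub>E \<alpha>\<in>J. {0..1})"

definition cube_gt :: "'j set \<Rightarrow> ('j \<Rightarrow> real) set set" where
  "cube_gt J = gt_product J (\<lambda>_. {0..1}) (\<lambda>_. gamma0)"

definition completely_regular :: "'a set \<Rightarrow> 'a set set \<Rightarrow> bool" where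
  "completely_regular X \<mu> \<longleftrightarrow>
     (\<forall>x\<in>X. \<forall>F. gt_closed X \<mu> F \<and> x \<notin> F \<longrightarrow>
        (\<exists>f. gt_continuous X \<mu> {0..1} gamma0 f \<and> f x = 0 \<and> f ` F \<subseteq> {1}))"

definition gt_T1 :: "'a set \<Rightarrow> 'a set set \<Rightarrow> bool" where
  "gt_T1 X \<mu> \<longleftrightarrow> (\<forall>x\<in>X. \<forall>y\<in>X. x \<noteq> y \<longrightarrow> (\<exists>M\<in>\<mu>. x \<in> M \<and> y \<notin> M))"

definition gt_T35 :: "'a set \<Rightarrow> 'a set set \<Rightarrow> bool" where
  "gt_T35 X \<mu> \<longleftrightarrow> completely_regular X \<mu> \<and> gt_T1 X \<mu>"

text \<open>Existence of ``some set \<open>J\<close>'' has to name a type for the elements of \<open>J\<close>.  The predicates below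
  take \<open>J\<close> as an argument, so that it can be quantified at any type.\<close>

definition embeds_in_cube :: "'a set \<Rightarrow> 'a set set \<Rightarrow> 'j set \<Rightarrow> bool" where
  "embeds_in_cube X \<mu> J \<longleftrightarrow>
     (\<exists>Y. Y \<subseteq> cube J \<and> gt_homeomorphic X \<mu> Y (gt_subspace (cube_gt J) Y))"

definition embeds_densely_in_cube :: "'a set \<Rightarrow> 'a set set \<Rightarrow> 'j set \<Rightarrow> bool" where
  "embeds_densely_in_cube X \<mu> J \<longleftrightarrow>
     (\<exists>Y. Y \<subseteq> cube J \<and> gt_homeomorphic X \<mu> Y (gt_subspace (cube_gt J) Y) \<and>
          gt_dense (cube J) (cube_gt J) Y)"

definition weak_from_cube :: "'a set \<Rightarrow> 'a set set \<Rightarrow> 'j set \<Rightarrow> bool" where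
  "weak_from_cube X \<mu> J \<longleftrightarrow>
     (\<exists>\<phi>. \<phi> \<in> X \<rightarrow> cube J \<and> \<mu> = weak_structure X (cube_gt J) \<phi>)"

definition weak_from_cube_densely :: "'a set \<Rightarrow> 'a set set \<Rightarrow> 'j set \<Rightarrow> bool" where
  "weak_from_cube_densely X \<mu> J \<longleftrightarrow>
     (\<exists>\<phi>. \<phi> \<in> X \<rightarrow> cube J \<and> \<mu> = weak_structure X (cube_gt J) \<phi> \<and>
          gt_dense (cube J) (cube_gt J) (\<phi> ` X))"

end

theory Submission
  imports Defs
begin

text \<open>
  Both parts are about one construction.  Given a family \<open>J\<close> of continuous functions from \<open>X\<close> to
  the interval, evaluation sends \<open>x\<close> to the point of the cube whose \<open>f\<close>-th coordinate is \<open>f x\<close>.  An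
  open set of a product of generalized topologies is a union of cylinders over a single coordinate,
  with no intersections, so the weak structure of the evaluation map consists exactly of the
  unions of sets \<open>f -` N\<close> with \<open>f \<in> J\<close> and \<open>N\<close> open in the interval.  Hence it is \<open>\<mu>\<close> as soon as
  these sets separate each point of an open set from the complement, and complete regularity
  provides such functions (\<open>weak_structure_evaluation\<close>).

  Conversely, an open set of a cube around a point contains, in one coordinate, a ray around the
  coordinate of that point.  A clamped affine function of this coordinate is \<open>0\<close> at the point and
  \<open>1\<close> off the ray, and a monotone continuous function pulls rays back to rays or
  trivial sets; this is why the weak structure
  of any map into a cube is completely regular (\<open>weak_from_cube_imp_completely_regular\<close>).

  For density one keeps in \<open>J\<close> only the functions attaining both \<open>0\<close> and \<open>1\<close>.  A nonempty open
  subset of the interval contains an end point, so the image then meets every nonempty cylinder.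
  The functions separating a point from a nonempty closed set attain both values, so nothing is lost
  for proper open sets; and if some nonempty proper open set exists then \<open>J\<close> is nonempty, which
  makes \<open>X\<close> open in the weak structure as well.

  Part (a) reduces to part (b): a space embeds into a cube if and only if it is \<open>T\<^sub>1\<close> and some map
  into the cube induces \<open>\<mu>\<close> as its weak structure (\<open>embeds_in_cube_iff\<close>).
\<close>

section \<open>The generalized topology of the interval\<close>

definition rays :: "real set set" where
  "rays = {{..<s} | s. True} \<union> {{t<..} | t. True}"

lemma gamma0_iff: "N \<in> gamma0 \<longleftrightarrow> (\<exists>S. S \<subseteq> rays \<and> N = \<Union>S \<inter> {0..1})"
  unfolding gamma0_def gt_subspace_def gamma_def gt_of_base_def rays_def by blast

lemma ray_in_gamma0: "B \<in> rays \<Longrightarrow> B \<inter> {0..1} \<in> gamma0"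
  unfolding gamma0_iff by (intro exI[of _ "{B}"]) auto

lemma interval_in_gamma0: "{0..1} \<in> gamma0"
  unfolding gamma0_iff by (intro exI[of _ "{{..<2}}"]) (auto simp: rays_def)

lemma empty_in_gamma0: "{} \<in> gamma0"
  unfolding gamma0_iff by (intro exI[of _ "{}"]) auto

lemma gamma0_contains_ray:
  assumes "N \<in> gamma0" "a \<in> N"
  obtains B where "B \<in> rays" "a \<in> B" "B \<inter> {0..1} \<subseteq> N"
  using assms unfolding gamma0_iff by blast

lemma gamma0_contains_endpoint:
  assumes "N \<in> gamma0" "N \<noteq> {}"
  shows "0 \<in> N \<or> 1 \<in> N"
proof -
  from assms obtain a where a: "a \<in> N" by blast
  then obtain B where B: "B \<in> rays" "a \<in> B" "B \<inter> {0..1} \<subseteq> N"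
    using gamma0_contains_ray assms(1) by blast
  have "a \<in> {0..1}"
    using a assms(1) unfolding gamma0_iff by blast
  then have "0 \<in> B \<or> 1 \<in> B"
    using B(1,2) unfolding rays_def by auto
  then show ?thesis using B(3) by auto
qed

text \<open>Preimages commute with unions, so continuity into the interval need only be tested on rays.\<close>

lemma continuous_gamma0I:
  assumes "gen_topology X \<mu>" and "f \<in> X \<rightarrow> {0..1}"
    and "\<And>r. {x \<in> X. f x < r} \<in> \<mu>" and "\<And>r. {x \<in> X. r < f x} \<in> \<mu>"
  shows "gt_continuous X \<mu> {0..1} gamma0 f"
  unfolding gt_continuous_def
proof (intro conjI ballI)
  fix N assume "N \<in> gamma0"
  then obtain S where S: "S \<subseteq> rays" "N = \<Union>S \<inter> {0..1}"
    unfolding gamma0_iff by blast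
  have "f -` B \<inter> X \<in> \<mu>" if "B \<in> rays" for B
  proof -
    from that consider r where "B = {..<r}" | r where "B = {r<..}"
      unfolding rays_def by blast
    then show ?thesis
    proof cases
      case 1
      then have "f -` B \<inter> X = {x \<in> X. f x < r}" by auto
      then show ?thesis using assms(3) by simp
    next
      case 2
      then have "f -` B \<inter> X = {x \<in> X. r < f x}" by auto
      then show ?thesis using assms(4) by simp
    qed
  qed
  then have "(\<lambda>B. f -` B \<inter> X) ` S \<subseteq> \<mu>" using S(1) by blast
  then have "\<Union>((\<lambda>B. f -` B \<inter> X) ` S) \<in> \<mu>"
    using assms(1) unfolding gen_topology_def by blast
  moreover have "f -` N \<inter> X = \<Union>((\<lambda>B. f -` B \<inter> X) ` S)"
    using S(2) assms(2) by auto
  ultimately show "f -` N \<inter> X \<in> \<mu>" by simp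
qed (rule assms(2))

lemma continuous_gamma0_rays:
  assumes "gt_continuous X \<mu> {0..1} gamma0 f"
  shows "X \<in> \<mu>" and "{x \<in> X. f x < r} \<in> \<mu>" and "{x \<in> X. r < f x} \<in> \<mu>"
proof -
  have f: "f x \<in> {0..1}" if "x \<in> X" for x
    using assms that unfolding gt_continuous_def by blast
  have pre: "f -` N \<inter> X \<in> \<mu>" if "N \<in> gamma0" for N
    using assms that unfolding gt_continuous_def by blast
  have "f -` {0..1} \<inter> X = X" using f by auto
  then show "X \<in> \<mu>" using pre[OF interval_in_gamma0] by simp
  have "f -` ({..<r} \<inter> {0..1}) \<inter> X = {x \<in> X. f x < r}" using f by auto
  moreover have "{..<r} \<in> rays" unfolding rays_def by blast
  ultimately show "{x \<in> X. f x < r} \<in> \<mu>" using pre[OF ray_in_gamma0] by metis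
  have "f -` ({r<..} \<inter> {0..1}) \<inter> X = {x \<in> X. r < f x}" using f by auto
  moreover have "{r<..} \<in> rays" unfolding rays_def by blast
  ultimately show "{x \<in> X. r < f x} \<in> \<mu>" using pre[OF ray_in_gamma0] by metis
qed

text \<open>Clamping to the interval creates, besides rays, only the preimages \<open>{}\<close> and \<open>X\<close>; the latter
  is open because a continuous function into the interval exists.  The case \<open>c < 0\<close> reverses the
  interval, which serves the upward rays.\<close>

lemma continuous_clamped_affine:
  assumes gt: "gen_topology X \<mu>" and f: "gt_continuous X \<mu> {0..1} gamma0 f" and "c \<noteq> 0"
  shows "gt_continuous X \<mu> {0..1} gamma0 (\<lambda>x. max 0 (min 1 ((f x - a) / c)))"
proof (rule continuous_gamma0I[OF gt])
  let ?g = "\<lambda>x. max 0 (min 1 ((f x - a) / c))"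
  have empty: "{} \<in> \<mu>" using gt unfolding gen_topology_def by blast
  show "?g \<in> X \<rightarrow> {0..1}" by auto
  fix r :: real
  consider "r \<le> 0" | "r > 1" | "0 < r" "r \<le> 1" by linarith
  then show "{x \<in> X. ?g x < r} \<in> \<mu>"
  proof cases
    case 1
    then have "{x \<in> X. ?g x < r} = {}" by auto
    then show ?thesis using empty by (simp only:)
  next
    case 2
    then have "{x \<in> X. ?g x < r} = X" by auto
    then show ?thesis using continuous_gamma0_rays(1)[OF f] by (simp only:)
  next
    case 3
    then have "{x \<in> X. ?g x < r} = {x \<in> X. (f x - a) / c < r}" by auto
    also have "\<dots> = (if c > 0 then {x \<in> X. f x < a + r * c} else {x \<in> X. a + r * c < f x})"
      using \<open>c \<noteq> 0\<close> by (auto simp: divide_simps algebra_simps)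
    finally have eq: "{x \<in> X. ?g x < r} = (if c > 0 then {x \<in> X. f x < a + r * c} else {x \<in> X. a + r * c < f x})" .
    show ?thesis unfolding eq using continuous_gamma0_rays(2,3)[OF f] by simp
  qed
  consider "r < 0" | "r \<ge> 1" | "0 \<le> r" "r < 1" by linarith
  then show "{x \<in> X. r < ?g x} \<in> \<mu>"
  proof cases
    case 1
    then have "{x \<in> X. r < ?g x} = X" by auto
    then show ?thesis using continuous_gamma0_rays(1)[OF f] by (simp only:)
  next
    case 2
    then have "{x \<in> X. r < ?g x} = {}" by auto
    then show ?thesis using empty by (simp only:)
  next
    case 3
    then have "{x \<in> X. r < ?g x} = {x \<in> X. r < (f x - a) / c}" by auto
    also have "\<dots> = (if c > 0 then {x \<in> X. a + r * c < f x} else {x \<in> X. f x < a + r * c})"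
      using \<open>c \<noteq> 0\<close> by (auto simp: divide_simps algebra_simps)
    finally have eq: "{x \<in> X. r < ?g x} = (if c > 0 then {x \<in> X. a + r * c < f x} else {x \<in> X. f x < a + r * c})" .
    show ?thesis unfolding eq using continuous_gamma0_rays(2,3)[OF f] by simp
  qed
qed

section \<open>Cubes\<close>

lemma cube_gt_iff:
  "N \<in> cube_gt J \<longleftrightarrow>
     (\<exists>M. (\<forall>\<alpha>\<in>J. M \<alpha> \<in> gamma0) \<and> N = {y \<in> cube J. \<exists>\<alpha>\<in>J. y \<alpha> \<in> M \<alpha>})"
proof -
  have "(\<Union>\<alpha>\<in>J. (\<lambda>y. y \<alpha>) -` M \<alpha> \<inter> cube J) = {y \<in> cube J. \<exists>\<alpha>\<in>J. y \<alpha> \<in> M \<alpha>}"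
    for M :: "'a \<Rightarrow> real set" by auto
  then show ?thesis
    unfolding cube_gt_def gt_product_def cube_def[symmetric] by (auto simp: conj_commute)
qed

lemma cylinder_in_cube_gt:
  assumes "\<alpha> \<in> J" "N \<in> gamma0"
  shows "{y \<in> cube J. y \<alpha> \<in> N} \<in> cube_gt J"
  unfolding cube_gt_iff
  by (rule exI[of _ "\<lambda>\<beta>. if \<beta> = \<alpha> then N else {}"]) (use assms empty_in_gamma0 in auto)

lemma cubeD: "y \<in> cube J \<Longrightarrow> \<alpha> \<in> J \<Longrightarrow> y \<alpha> \<in> {0..1}"
  unfolding cube_def by blast

text \<open>Only single coordinates have to be examined: a nonempty open set contains a nonempty cylinder,
  whose base in turn contains an end point of the interval.\<close>

lemma dense_in_cubeI:
  assumes sub: "A \<subseteq> cube J"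
    and ends: "\<And>\<alpha> e. \<alpha> \<in> J \<Longrightarrow> e \<in> {0, 1} \<Longrightarrow> \<exists>y\<in>A. y \<alpha> = e"
  shows "gt_dense (cube J) (cube_gt J) A"
proof -
  have "{} \<in> cube_gt J"
    unfolding cube_gt_iff using empty_in_gamma0 by (intro exI[of _ "\<lambda>_. {}"]) auto
  then have "gt_closed (cube J) (cube_gt J) (cube J)"
    unfolding gt_closed_def by simp
  then have "gt_closure (cube J) (cube_gt J) A \<subseteq> cube J"
    using sub unfolding gt_closure_def by blast
  moreover have "cube J \<subseteq> F" if F: "gt_closed (cube J) (cube_gt J) F" "A \<subseteq> F" for F
  proof (rule ccontr)
    assume "\<not> cube J \<subseteq> F"
    then obtain y where y: "y \<in> cube J - F" by blast
    obtain M where M: "\<forall>\<alpha>\<in>J. M \<alpha> \<in> gamma0" "cube J - F = {y \<in> cube J. \<exists>\<alpha>\<in>J. y \<alpha> \<in> M \<alpha>}"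
      using F(1) unfolding gt_closed_def cube_gt_iff by blast
    then obtain \<alpha> where \<alpha>: "\<alpha> \<in> J" "y \<alpha> \<in> M \<alpha>" using y by blast
    then have "0 \<in> M \<alpha> \<or> 1 \<in> M \<alpha>" using gamma0_contains_endpoint M(1) by blast
    then obtain z where "z \<in> A" "z \<alpha> \<in> M \<alpha>" using ends[OF \<alpha>(1)] by (metis insertI1 insertI2)
    then have "z \<in> cube J - F" using M(2) \<alpha>(1) sub by blast
    then show False using \<open>z \<in> A\<close> F(2) by blast
  qed
  ultimately show ?thesis using sub unfolding gt_dense_def gt_closure_def by blast
qed

section \<open>Weak structures of maps into cubes\<close>

lemma weak_structure_coordinate_continuous:
  assumes "\<phi> \<in> X \<rightarrow> cube J" "\<alpha> \<in> J"
  shows "gt_continuous X (weak_structure X (cube_gt J) \<phi>) {0..1} gamma0 (\<lambda>x. \<phi> x \<alpha>)"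
  unfolding gt_continuous_def
proof (intro conjI ballI)
  show "(\<lambda>x. \<phi> x \<alpha>) \<in> X \<rightarrow> {0..1}"
    using assms by (intro Pi_I cubeD[of _ J]) auto
  fix N assume "N \<in> gamma0"
  then have "{y \<in> cube J. y \<alpha> \<in> N} \<in> cube_gt J" by (rule cylinder_in_cube_gt[OF assms(2)])
  moreover have "(\<lambda>x. \<phi> x \<alpha>) -` N \<inter> X = \<phi> -` {y \<in> cube J. y \<alpha> \<in> N} \<inter> X"
    using assms(1) by auto
  ultimately show "(\<lambda>x. \<phi> x \<alpha>) -` N \<inter> X \<in> weak_structure X (cube_gt J) \<phi>"
    unfolding weak_structure_def by blast
qed

lemma weak_from_cube_imp_completely_regular:
  assumes gt: "gen_topology X \<mu>" and "weak_from_cube X \<mu> J"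
  shows "completely_regular X \<mu>"
  unfolding completely_regular_def
proof (intro ballI allI impI)
  fix x F assume x: "x \<in> X" and F: "gt_closed X \<mu> F \<and> x \<notin> F"
  from assms(2) obtain \<phi> where \<phi>: "\<phi> \<in> X \<rightarrow> cube J" "\<mu> = weak_structure X (cube_gt J) \<phi>"
    unfolding weak_from_cube_def by blast
  obtain N where "N \<in> cube_gt J" and N: "X - F = \<phi> -` N \<inter> X"
    using F \<phi>(2) unfolding gt_closed_def weak_structure_def by blast
  then obtain M where M: "\<forall>\<alpha>\<in>J. M \<alpha> \<in> gamma0" "N = {y \<in> cube J. \<exists>\<alpha>\<in>J. y \<alpha> \<in> M \<alpha>}"
    unfolding cube_gt_iff by blast
  have "\<phi> x \<in> N" using N x F by blast
  then obtain \<alpha> where \<alpha>: "\<alpha> \<in> J" "\<phi> x \<alpha> \<in> M \<alpha>" using M(2) by blast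
  then obtain B where B: "B \<in> rays" "\<phi> x \<alpha> \<in> B" "B \<inter> {0..1} \<subseteq> M \<alpha>"
    using gamma0_contains_ray M(1) by blast
  have off: "\<phi> y \<alpha> \<notin> B" if y: "y \<in> F" for y
  proof
    assume "\<phi> y \<alpha> \<in> B"
    have "y \<in> X" using y F unfolding gt_closed_def by blast
    then have \<phi>y: "\<phi> y \<in> cube J" using \<phi>(1) by blast
    have "\<phi> y \<alpha> \<in> M \<alpha>" using cubeD[OF \<phi>y \<alpha>(1)] B(3) \<open>\<phi> y \<alpha> \<in> B\<close> by blast
    then have "\<phi> y \<in> N" using \<phi>y \<alpha>(1) unfolding M(2) by blast
    then show False using N y \<open>y \<in> X\<close> by blast
  qed
  \<comment> \<open>The affine function with value 0 at the coordinate of \<open>x\<close> and 1 at the end \<open>r\<close> of the ray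
    is at least 1 everywhere off the ray, whichever way the ray points.\<close>
  from B(1,2) obtain r where r: "r \<noteq> \<phi> x \<alpha>"
    "\<And>u. u \<notin> B \<Longrightarrow> (u - \<phi> x \<alpha>) / (r - \<phi> x \<alpha>) \<ge> 1"
  proof -
    from B(1) consider s where "B = {..<s}" | t where "B = {t<..}"
      unfolding rays_def by blast
    then show thesis
    proof cases
      case 1
      then show thesis using B(2) by (intro that[of s]) (auto simp: divide_simps)
    next
      case 2
      then show thesis using B(2) by (intro that[of t]) (auto simp: divide_simps)
    qed
  qed
  let ?f = "\<lambda>y. max 0 (min 1 ((\<phi> y \<alpha> - \<phi> x \<alpha>) / (r - \<phi> x \<alpha>)))"
  have "gt_continuous X \<mu> {0..1} gamma0 ?f"
    using continuous_clamped_affine[OF gt, of "\<lambda>y. \<phi> y \<alpha>" "r - \<phi> x \<alpha>"] r(1)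
      weak_structure_coordinate_continuous[OF \<phi>(1) \<alpha>(1), folded \<phi>(2)] by simp
  moreover have "?f ` F \<subseteq> {1}" using off r(2) by fastforce
  ultimately show "\<exists>f. gt_continuous X \<mu> {0..1} gamma0 f \<and> f x = 0 \<and> f ` F \<subseteq> {1}"
    by (intro exI[of _ ?f]) auto
qed

definition evaluation :: "('a \<Rightarrow> real) set \<Rightarrow> 'a \<Rightarrow> ('a \<Rightarrow> real) \<Rightarrow> real" where
  "evaluation J x = (\<lambda>f\<in>J. f x)"

lemma evaluation_in_cube:
  assumes "\<And>f. f \<in> J \<Longrightarrow> gt_continuous X \<mu> {0..1} gamma0 f"
  shows "evaluation J \<in> X \<rightarrow> cube J"
proof
  fix x assume "x \<in> X"
  then have "f x \<in> {0..1}" if "f \<in> J" for f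
    using assms[OF that] unfolding gt_continuous_def by blast
  then show "evaluation J x \<in> cube J"
    unfolding evaluation_def cube_def by (simp add: restrict_PiE_iff)
qed

lemma evaluation_apply: "f \<in> J \<Longrightarrow> evaluation J x f = f x"
  unfolding evaluation_def by simp

text \<open>The absence of intersections in the product is what makes a local condition on \<open>J\<close> suffice:
  an open set is the union of all preimages of rays under members of \<open>J\<close> contained in it, and those
  belonging to one \<open>f\<close> combine into a single open set of the \<open>f\<close>-th coordinate.\<close>

lemma weak_structure_evaluation:
  assumes gt: "gen_topology X \<mu>"
    and cont: "\<And>f. f \<in> J \<Longrightarrow> gt_continuous X \<mu> {0..1} gamma0 f"
    and sep: "\<And>M x. M \<in> \<mu> \<Longrightarrow> x \<in> M \<Longrightarrow> \<exists>f\<in>J. \<exists>B\<in>rays. f x \<in> B \<and> f -` B \<inter> X \<subseteq> M"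
  shows "\<mu> = weak_structure X (cube_gt J) (evaluation J)"
proof (rule antisym)
  have "evaluation J \<in> X \<rightarrow> cube J" by (rule evaluation_in_cube) (rule cont)
  then have ev: "evaluation J x \<in> cube J" if "x \<in> X" for x
    using that by (rule funcset_mem)
  show "weak_structure X (cube_gt J) (evaluation J) \<subseteq> \<mu>"
  proof
    fix W assume "W \<in> weak_structure X (cube_gt J) (evaluation J)"
    then obtain M where M: "\<forall>f\<in>J. M f \<in> gamma0"
        "W = evaluation J -` {y \<in> cube J. \<exists>f\<in>J. y f \<in> M f} \<inter> X"
      unfolding weak_structure_def cube_gt_iff by blast
    have "(\<lambda>f. f -` M f \<inter> X) ` J \<subseteq> \<mu>"
      using M(1) cont unfolding gt_continuous_def by blast
    then have "\<Union>((\<lambda>f. f -` M f \<inter> X) ` J) \<in> \<mu>"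
      using gt unfolding gen_topology_def by blast
    moreover have "W = \<Union>((\<lambda>f. f -` M f \<inter> X) ` J)"
      using M(2) ev by (auto simp: evaluation_apply)
    ultimately show "W \<in> \<mu>" by simp
  qed
  show "\<mu> \<subseteq> weak_structure X (cube_gt J) (evaluation J)"
  proof
    fix W assume W: "W \<in> \<mu>"
    define M where "M f = \<Union>{B \<in> rays. f -` B \<inter> X \<subseteq> W} \<inter> {0..1}" for f :: "'a \<Rightarrow> real"
    have "M f \<in> gamma0" for f
      unfolding M_def gamma0_iff by (intro exI[of _ "{B \<in> rays. f -` B \<inter> X \<subseteq> W}"]) simp
    then have "{y \<in> cube J. \<exists>f\<in>J. y f \<in> M f} \<in> cube_gt J"
      unfolding cube_gt_iff by (intro exI[of _ M]) simp
    moreover have "W = evaluation J -` {y \<in> cube J. \<exists>f\<in>J. y f \<in> M f} \<inter> X"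
    proof (intro set_eqI iffI)
      fix x assume x: "x \<in> W"
      then have xX: "x \<in> X" using W gt unfolding gen_topology_def by blast
      obtain f B where f: "f \<in> J" "B \<in> rays" "f x \<in> B" "f -` B \<inter> X \<subseteq> W"
        using sep[OF W x] by blast
      moreover have "f x \<in> {0..1}" using cont[OF f(1)] xX unfolding gt_continuous_def by blast
      ultimately have "evaluation J x f \<in> M f"
        unfolding M_def evaluation_apply[OF f(1)] by blast
      then show "x \<in> evaluation J -` {y \<in> cube J. \<exists>f\<in>J. y f \<in> M f} \<inter> X"
        using f(1) xX ev[OF xX] by blast
    next
      fix x assume "x \<in> evaluation J -` {y \<in> cube J. \<exists>f\<in>J. y f \<in> M f} \<inter> X"
      then show "x \<in> W" by (auto simp: M_def evaluation_apply)
    qed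
    ultimately show "W \<in> weak_structure X (cube_gt J) (evaluation J)"
      unfolding weak_structure_def by blast
  qed
qed

lemma completely_regular_separation:
  assumes "gen_topology X \<mu>" "completely_regular X \<mu>" "M \<in> \<mu>" "x \<in> M"
  obtains f where "gt_continuous X \<mu> {0..1} gamma0 f" "f x = 0" "\<And>y. y \<in> X - M \<Longrightarrow> f y = 1"
proof -
  have "M \<subseteq> X" using assms(1,3) unfolding gen_topology_def by blast
  then have "gt_closed X \<mu> (X - M)" "x \<in> X" "x \<notin> X - M"
    using assms(3,4) unfolding gt_closed_def by (auto simp: double_diff)
  then obtain f where "gt_continuous X \<mu> {0..1} gamma0 f" "f x = 0" "f ` (X - M) \<subseteq> {1}"
    using assms(2)[unfolded completely_regular_def, rule_format, of x "X - M"] by auto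
  then show thesis by (intro that[of f]) auto
qed

lemma completely_regular_imp_weak_from_cube:
  fixes X :: "'a set"
  assumes gt: "gen_topology X \<mu>" and cr: "completely_regular X \<mu>"
  shows "\<exists>J :: ('a \<Rightarrow> real) set. weak_from_cube X \<mu> J"
proof -
  let ?J = "{f. gt_continuous X \<mu> {0..1} gamma0 f}"
  have "\<mu> = weak_structure X (cube_gt ?J) (evaluation ?J)"
  proof (rule weak_structure_evaluation[OF gt])
    fix M x assume "M \<in> \<mu>" "x \<in> M"
    then obtain f where f: "gt_continuous X \<mu> {0..1} gamma0 f" "f x = 0"
        "\<And>y. y \<in> X - M \<Longrightarrow> f y = 1"
      using completely_regular_separation[OF gt cr] by blast
    then have "f -` {..<1} \<inter> X \<subseteq> M" by fastforce
    moreover have "{..<1} \<in> rays" unfolding rays_def by blast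
    ultimately show "\<exists>f\<in>?J. \<exists>B\<in>rays. f x \<in> B \<and> f -` B \<inter> X \<subseteq> M"
      using f by (intro bexI[of _ f] bexI[of _ "{..<1}"]) auto
  qed simp
  moreover have "evaluation ?J \<in> X \<rightarrow> cube ?J" by (rule evaluation_in_cube[where \<mu> = \<mu>]) simp
  ultimately show ?thesis
    unfolding weak_from_cube_def by (intro exI[of _ ?J] exI[of _ "evaluation ?J"] conjI)
qed

lemma completely_regular_imp_weak_from_cube_densely:
  fixes X :: "'a set"
  assumes gt: "gen_topology X \<mu>" and cr: "completely_regular X \<mu>" and "\<not> \<mu> \<subseteq> {{}, X}"
  shows "\<exists>J :: ('a \<Rightarrow> real) set. weak_from_cube_densely X \<mu> J"
proof -
  let ?J = "{f. gt_continuous X \<mu> {0..1} gamma0 f \<and> 0 \<in> f ` X \<and> 1 \<in> f ` X}"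
  have proper: "\<exists>f\<in>?J. f x = 0 \<and> f -` {..<1} \<inter> X \<subseteq> M"
    if M: "M \<in> \<mu>" "M \<noteq> X" "x \<in> M" for M x
  proof -
    obtain f where f: "gt_continuous X \<mu> {0..1} gamma0 f" "f x = 0"
        "\<And>y. y \<in> X - M \<Longrightarrow> f y = 1"
      using completely_regular_separation[OF gt cr M(1,3)] by blast
    have "M \<subseteq> X" using M(1) gt unfolding gen_topology_def by blast
    then obtain y where "y \<in> X - M" "x \<in> X" using M(2,3) by blast
    then have "0 \<in> f ` X" "1 \<in> f ` X"
      using f(2) f(3) by (metis imageI, metis DiffD1 imageI)
    moreover have "f -` {..<1} \<inter> X \<subseteq> M" using f(3) by fastforce
    ultimately show ?thesis using f(1,2) by blast
  qed
  have "\<mu> = weak_structure X (cube_gt ?J) (evaluation ?J)"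
  proof (rule weak_structure_evaluation[OF gt])
    fix M x assume M: "M \<in> \<mu>" "x \<in> M"
    show "\<exists>f\<in>?J. \<exists>B\<in>rays. f x \<in> B \<and> f -` B \<inter> X \<subseteq> M"
    proof (cases "M = X")
      case True
      obtain f where f: "f \<in> ?J" using proper assms(3) by blast
      \<comment> \<open>A function separating a point from the empty set could be constant, so take any member
        of the family and a ray containing the whole interval.\<close>
      have "f x \<in> {0..1}" using f M(2) True unfolding gt_continuous_def by blast
      moreover have "{..<2} \<in> rays" unfolding rays_def by blast
      ultimately show ?thesis
        using f True by (intro bexI[of _ f] bexI[of _ "{..<2}"]) auto
    next
      case False
      moreover have "{..<1} \<in> rays" unfolding rays_def by blast
      ultimately show ?thesis using proper[OF M(1) _ M(2)]
        by (metis (no_types, lifting) lessThan_iff zero_less_one)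
    qed
  qed simp
  moreover have ev: "evaluation ?J \<in> X \<rightarrow> cube ?J" by (rule evaluation_in_cube[where \<mu> = \<mu>]) simp
  moreover have "gt_dense (cube ?J) (cube_gt ?J) (evaluation ?J ` X)"
  proof (rule dense_in_cubeI)
    show "evaluation ?J ` X \<subseteq> cube ?J" using ev by blast
    fix f and e :: real assume f: "f \<in> ?J" and "e \<in> {0, 1}"
    then have "e \<in> f ` X" by auto
    then obtain x where x: "x \<in> X" "f x = e" by (auto elim: imageE)
    show "\<exists>y\<in>evaluation ?J ` X. y f = e"
    proof
      show "evaluation ?J x f = e" using evaluation_apply[OF f] x(2) by (rule trans)
      show "evaluation ?J x \<in> evaluation ?J ` X" using x(1) by (rule imageI)
    qed
  qed
  ultimately show ?thesis
    unfolding weak_from_cube_densely_def by (intro exI[of _ ?J] exI[of _ "evaluation ?J"] conjI)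
qed

section \<open>Embeddings into cubes\<close>

lemma homeomorphism_imp_weak_structure:
  assumes "gen_topology X \<mu>" and "gt_homeomorphism X \<mu> Y (gt_subspace \<nu> Y) f"
  shows "\<mu> = weak_structure X \<nu> f"
proof -
  have bij: "bij_betw f X Y" and cont: "gt_continuous X \<mu> Y (gt_subspace \<nu> Y) f"
    and inv: "gt_continuous Y (gt_subspace \<nu> Y) X \<mu> (inv_into X f)"
    using assms(2) unfolding gt_homeomorphism_def by auto
  show ?thesis
  proof (intro set_eqI iffI)
    fix M assume M: "M \<in> \<mu>"
    then have "inv_into X f -` M \<inter> Y \<in> gt_subspace \<nu> Y"
      using inv unfolding gt_continuous_def by simp
    then obtain N where N: "N \<in> \<nu>" "inv_into X f -` M \<inter> Y = N \<inter> Y"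
      unfolding gt_subspace_def by auto
    have "x \<in> M \<longleftrightarrow> f x \<in> N" if "x \<in> X" for x
    proof -
      have "f x \<in> Y" "inv_into X f (f x) = x" using bij that by (auto simp: bij_betw_def)
      then show ?thesis using arg_cong[OF N(2), of "\<lambda>S. f x \<in> S"] by simp
    qed
    moreover have "M \<subseteq> X" using M assms(1) unfolding gen_topology_def by blast
    ultimately have "M = f -` N \<inter> X" by auto
    then show "M \<in> weak_structure X \<nu> f" using N(1) unfolding weak_structure_def by blast
  next
    fix M assume "M \<in> weak_structure X \<nu> f"
    then obtain N where N: "N \<in> \<nu>" "M = f -` N \<inter> X" unfolding weak_structure_def by blast
    have "N \<inter> Y \<in> gt_subspace \<nu> Y" using N(1) unfolding gt_subspace_def by blast
    then have "f -` (N \<inter> Y) \<inter> X \<in> \<mu>"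
      using cont unfolding gt_continuous_def by (simp del: vimage_Int)
    moreover have "f -` (N \<inter> Y) \<inter> X = M" using N(2) bij by (auto simp: bij_betw_def)
    ultimately show "M \<in> \<mu>" by simp
  qed
qed

text \<open>Injectivity comes for free: points with the same image lie in the same sets of the weak
  structure, which the separation axiom forbids for distinct points.\<close>

lemma weak_structure_T1_imp_homeomorphism:
  assumes "\<mu> = weak_structure X \<nu> f" "gt_T1 X \<mu>"
  shows "gt_homeomorphism X \<mu> (f ` X) (gt_subspace \<nu> (f ` X)) f"
proof -
  have inj: "inj_on f X"
  proof (rule inj_onI, rule ccontr)
    fix x y assume xy: "x \<in> X" "y \<in> X" "f x = f y" "x \<noteq> y"
    then obtain M where "M \<in> \<mu>" "x \<in> M" "y \<notin> M" using assms(2) unfolding gt_T1_def by blast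
    then show False using xy assms(1) unfolding weak_structure_def by auto
  qed
  have "gt_continuous X \<mu> (f ` X) (gt_subspace \<nu> (f ` X)) f"
    unfolding gt_continuous_def
  proof (intro conjI ballI)
    fix N assume "N \<in> gt_subspace \<nu> (f ` X)"
    then obtain N' where N': "N' \<in> \<nu>" "N = N' \<inter> f ` X" unfolding gt_subspace_def by blast
    then have "f -` N \<inter> X = f -` N' \<inter> X" by blast
    then show "f -` N \<inter> X \<in> \<mu>" using N'(1) assms(1) unfolding weak_structure_def by blast
  qed auto
  moreover have "gt_continuous (f ` X) (gt_subspace \<nu> (f ` X)) X \<mu> (inv_into X f)"
    unfolding gt_continuous_def
  proof (intro conjI ballI)
    show "inv_into X f \<in> f ` X \<rightarrow> X" by (auto intro: inv_into_into)
    fix M assume "M \<in> \<mu>"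
    then obtain N where N: "N \<in> \<nu>" "M = f -` N \<inter> X"
      using assms(1) unfolding weak_structure_def by blast
    then have "inv_into X f -` M \<inter> f ` X = N \<inter> f ` X" using inj by auto
    then show "inv_into X f -` M \<inter> f ` X \<in> gt_subspace \<nu> (f ` X)"
      using N(1) unfolding gt_subspace_def by blast
  qed
  ultimately show ?thesis
    using inj unfolding gt_homeomorphism_def by (simp add: bij_betw_def)
qed

lemma injective_weak_structure_T1:
  assumes "\<phi> \<in> X \<rightarrow> cube J" "inj_on \<phi> X"
  shows "gt_T1 X (weak_structure X (cube_gt J) \<phi>)"
  unfolding gt_T1_def
proof (intro ballI impI)
  fix x y assume xy: "x \<in> X" "y \<in> X" "x \<noteq> y"
  then have "\<phi> x \<noteq> \<phi> y" using assms(2) by (auto dest: inj_onD)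
  moreover have "\<phi> x \<in> cube J" "\<phi> y \<in> cube J" using assms(1) xy by auto
  ultimately obtain \<alpha> where \<alpha>: "\<alpha> \<in> J" "\<phi> x \<alpha> \<noteq> \<phi> y \<alpha>"
    unfolding cube_def using PiE_ext by blast
  note rays = continuous_gamma0_rays(2,3)
    [OF weak_structure_coordinate_continuous[OF assms(1) \<alpha>(1)], of "\<phi> y \<alpha>"]
  show "\<exists>M\<in>weak_structure X (cube_gt J) \<phi>. x \<in> M \<and> y \<notin> M"
  proof (cases "\<phi> x \<alpha> < \<phi> y \<alpha>")
    case True
    then show ?thesis using xy(1) by (intro bexI[OF _ rays(1)]) simp
  next
    case False
    then have "\<phi> y \<alpha> < \<phi> x \<alpha>" using \<alpha>(2) by simp
    then show ?thesis using xy(1) by (intro bexI[OF _ rays(2)]) simp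
  qed
qed

lemma embeds_in_cube_iff:
  assumes gt: "gen_topology X \<mu>"
  shows "embeds_in_cube X \<mu> J \<longleftrightarrow> weak_from_cube X \<mu> J \<and> gt_T1 X \<mu>"
proof
  assume "embeds_in_cube X \<mu> J"
  then obtain Y f where Y: "Y \<subseteq> cube J"
      and f: "gt_homeomorphism X \<mu> Y (gt_subspace (cube_gt J) Y) f"
    unfolding embeds_in_cube_def gt_homeomorphic_def by blast
  have bij: "bij_betw f X Y" using f unfolding gt_homeomorphism_def by blast
  then have "f \<in> X \<rightarrow> cube J" using Y by (auto simp: bij_betw_def)
  moreover have "\<mu> = weak_structure X (cube_gt J) f"
    by (rule homeomorphism_imp_weak_structure[OF gt f])
  moreover from calculation have "gt_T1 X \<mu>"
    using injective_weak_structure_T1[OF _ bij_betw_imp_inj_on[OF bij]] by simp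
  ultimately show "weak_from_cube X \<mu> J \<and> gt_T1 X \<mu>"
    unfolding weak_from_cube_def by (intro conjI exI[of _ f])
next
  assume "weak_from_cube X \<mu> J \<and> gt_T1 X \<mu>"
  then obtain \<phi> where \<phi>: "\<phi> \<in> X \<rightarrow> cube J" "\<mu> = weak_structure X (cube_gt J) \<phi>" "gt_T1 X \<mu>"
    unfolding weak_from_cube_def by blast
  show "embeds_in_cube X \<mu> J"
    unfolding embeds_in_cube_def gt_homeomorphic_def
  proof (intro exI conjI)
    show "\<phi> ` X \<subseteq> cube J" using \<phi>(1) by blast
    show "gt_homeomorphism X \<mu> (\<phi> ` X) (gt_subspace (cube_gt J) (\<phi> ` X)) \<phi>"
      by (rule weak_structure_T1_imp_homeomorphism[OF \<phi>(2,3)])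
  qed
qed

lemma embeds_in_cube_imp_T35:
  assumes "gen_topology X \<mu>" "embeds_in_cube X \<mu> J"
  shows "gt_T35 X \<mu>"
  using assms(2) weak_from_cube_imp_completely_regular[OF assms(1)]
  unfolding embeds_in_cube_iff[OF assms(1)] gt_T35_def by blast

lemma weak_from_cube_densely_T1_imp_embeds_densely:
  assumes "weak_from_cube_densely X \<mu> J" "gt_T1 X \<mu>"
  shows "embeds_densely_in_cube X \<mu> J"
proof -
  obtain \<phi> where \<phi>: "\<phi> \<in> X \<rightarrow> cube J" "\<mu> = weak_structure X (cube_gt J) \<phi>"
      "gt_dense (cube J) (cube_gt J) (\<phi> ` X)"
    using assms(1) unfolding weak_from_cube_densely_def by blast
  show ?thesis
    unfolding embeds_densely_in_cube_def gt_homeomorphic_def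
  proof (intro exI conjI)
    show "\<phi> ` X \<subseteq> cube J" using \<phi>(1) by blast
    show "gt_homeomorphism X \<mu> (\<phi> ` X) (gt_subspace (cube_gt J) (\<phi> ` X)) \<phi>"
      by (rule weak_structure_T1_imp_homeomorphism[OF \<phi>(2) assms(2)])
  qed (rule \<phi>(3))
qed

theorem theorem4p12:
  fixes X :: "'a set" and \<mu> :: "'a set set"
  assumes "gen_topology X \<mu>"
  shows
    "((gt_T35 X \<mu> \<longleftrightarrow> (\<exists>J :: ('a \<Rightarrow> real) set. embeds_in_cube X \<mu> J)) \<and>
      (\<forall>J :: 'j set. embeds_in_cube X \<mu> J \<longrightarrow> gt_T35 X \<mu>) \<and>
      ((\<exists>x\<in>X. \<exists>y\<in>X. x \<noteq> y) \<and> gt_T35 X \<mu> \<longrightarrow>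
         (\<exists>J :: ('a \<Rightarrow> real) set. embeds_densely_in_cube X \<mu> J))) \<and>
     ((completely_regular X \<mu> \<longleftrightarrow> (\<exists>J :: ('a \<Rightarrow> real) set. weak_from_cube X \<mu> J)) \<and>
      (\<forall>J :: 'j set. weak_from_cube X \<mu> J \<longrightarrow> completely_regular X \<mu>) \<and>
      (\<not> \<mu> \<subseteq> {{}, X} \<and> completely_regular X \<mu> \<longrightarrow>
         (\<exists>J :: ('a \<Rightarrow> real) set. weak_from_cube_densely X \<mu> J)))"
proof -
  note gt = assms
  \<comment> \<open>Two distinct points of a \<open>T\<^sub>1\<close> space are separated by a nonempty proper open set, so the
    dense version of the weak structure statement applies.\<close>
  have nontrivial: "\<not> \<mu> \<subseteq> {{}, X}" if "\<exists>x\<in>X. \<exists>y\<in>X. x \<noteq> y" "gt_T1 X \<mu>"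
    using that unfolding gt_T1_def by blast
  have "gt_T35 X \<mu> \<longleftrightarrow> (\<exists>J :: ('a \<Rightarrow> real) set. embeds_in_cube X \<mu> J)"
    using embeds_in_cube_imp_T35[OF gt] completely_regular_imp_weak_from_cube[OF gt]
    unfolding embeds_in_cube_iff[OF gt] gt_T35_def by blast
  moreover have "\<forall>J :: 'j set. embeds_in_cube X \<mu> J \<longrightarrow> gt_T35 X \<mu>"
    using embeds_in_cube_imp_T35[OF gt] by blast
  moreover have "(\<exists>x\<in>X. \<exists>y\<in>X. x \<noteq> y) \<and> gt_T35 X \<mu> \<longrightarrow>
      (\<exists>J :: ('a \<Rightarrow> real) set. embeds_densely_in_cube X \<mu> J)"
    using nontrivial completely_regular_imp_weak_from_cube_densely[OF gt]
      weak_from_cube_densely_T1_imp_embeds_densely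
    unfolding gt_T35_def by metis
  moreover have "completely_regular X \<mu> \<longleftrightarrow> (\<exists>J :: ('a \<Rightarrow> real) set. weak_from_cube X \<mu> J)"
    using completely_regular_imp_weak_from_cube[OF gt]
      weak_from_cube_imp_completely_regular[OF gt] by blast
  moreover have "\<forall>J :: 'j set. weak_from_cube X \<mu> J \<longrightarrow> completely_regular X \<mu>"
    using weak_from_cube_imp_completely_regular[OF gt] by blast
  moreover have "\<not> \<mu> \<subseteq> {{}, X} \<and> completely_regular X \<mu> \<longrightarrow>
      (\<exists>J :: ('a \<Rightarrow> real) set. weak_from_cube_densely X \<mu> J)"
    using completely_regular_imp_weak_from_cube_densely[OF gt] by blast
  ultimately show ?thesis by blast
qed

end
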